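(* Let $(\mu_t,T_t)$, with $\mu_t=\sum_{i\ge0}\mu_it^i$ and $T_t=\sum_{i\ge0}T_it^i$, be a formal one-parameter deformation of a Rota-Baxter Leibniz algebra $(\mathfrak{g}_T,\mu)$. Then $(\mu_1,T_1)$ is a $2$-cocycle in the cochain complex $\{C^n_{RBLA}(\mathfrak{g},\mathfrak{g}),d^n\}$, i.e. $d^2(\mu_1,T_1)=0$.
   Context: All vector spaces are over a fixed field $\mathbb{K}$. A (left) Leibniz algebra is a vector space $\mathfrak{g}$ with a bilinear bracket $\mu=[\,,\,]_{\mathfrak{g}}$ satisfying $[x,[y,z]_{\mathfrak{g}}]_{\mathfrak{g}}=[[x,y]_{\mathfrak{g}},z]_{\mathfrak{g}}+[y,[x,z]_{\mathfrak{g}}]_{\mathfrak{g}}$. A Rota-Baxter operator is a linear map $T:\mathfrak{g}\to\mathfrak{g}$ with $[T(x),T(y)]_{\mathfrak{g}}=T([T(x),y]_{\mathfrak{g}}+[x,T(y)]_{\mathfrak{g}})$. A Rota-Baxter Leibniz algebra $(\mathfrak{g}_T,\mu)$ is a Leibniz algebra together with a Rota-Baxter operator $T$. Cochain complex of $(\mathfrak{g}_T,\mu)$ with coefficients in itself. Put $C^n_{LA}(\mathfrak{g},\mathfrak{g})=C^n_{RBO}(\mathfrak{g},\mathfrak{g})=\mathrm{Hom}(\mathfrak{g}^{\otimes n},\mathfrak{g})$, $n\ge0$. For bilinear maps $l,r:\mathfrak{g}\times\mathfrak{g}\to\mathfrak{g}$ and a bracket $[\,,\,]$ on $\mathfrak{g}$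 consider the formula $$\begin{aligned}&\sum_{i=1}^{n}(-1)^{i+1}l(x_i,f(x_1,\dots,\widehat{x_i},\dots,x_{n+1}))+(-1)^{n+1}r(f(x_1,\dots,x_n),x_{n+1})\\&+\sum_{1\le i<j\le n+1}(-1)^i f(x_1,\dots,\widehat{x_i},\dots,x_{j-1},[x_i,x_j],x_{j+1},\dots,x_{n+1}).\end{aligned}$$ $(\delta^nf)(x_1,\dots,x_{n+1})$ is this expression with $l(x,u)=[x,u]_{\mathfrak{g}}$, $r(u,x)=[u,x]_{\mathfrak{g}}$ and bracket $[\,,\,]_{\mathfrak{g}}$; $(\partial^nf)(x_1,\dots,x_{n+1})$ is this expression with $l(x,u)=[T(x),u]_{\mathfrak{g}}-T([x,u]_{\mathfrak{g}})$, $r(u,x)=[u,T(x)]_{\mathfrak{g}}-T([u,x]_{\mathfrak{g}})$ and bracket $[x,y]_*=[x,T(y)]_{\mathfrak{g}}+[T(x),y]_{\mathfrak{g}}$. Also $$\phi^n(f)(x_1,\dots,x_n)=f(Tx_1,\dots,Tx_n)-\sum_{i=1}^n T\big(f(Tx_1,\dots,Tx_{i-1},x_i,Tx_{i+1},\dots,Tx_n)\big).$$ For $n\ge1$, $C^n_{RBLA}(\mathfrak{g},\mathfrak{g})=C^n_{LA}(\mathfrak{g},\mathfrak{g})\oplus C^{n-1}_{RBO}(\mathfrak{g},\mathfrak{g})$ and $d^n(\alpha,\beta)=(\delta^n(\alpha),-\partial^{n-1}(\beta)-\phi^n(\alpha))$. A formal one-parameter deformation of $(\mathfrak{g}_T,\mu)$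 is a pair of power series $\mu_t=\sum_{i\ge0}\mu_it^i$, $T_t=\sum_{i\ge0}T_it^i$ with $\mu_i:\mathfrak{g}\otimes\mathfrak{g}\to\mathfrak{g}$ and $T_i:\mathfrak{g}\to\mathfrak{g}$ linear, $(\mu_0,T_0)=(\mu,T)$, such that (extending $\mathbb{K}[[t]]$-linearly) $(\mathfrak{g}[[t]]_{T_t},\mu_t)$ is a Rota-Baxter Leibniz algebra; equivalently for all $x,y,z\in\mathfrak{g}$, as formal power series, $\mu_t(x,\mu_t(y,z))=\mu_t(\mu_t(x,y),z)+\mu_t(y,\mu_t(x,z))$ and $\mu_t(T_t(x),T_t(y))=T_t(\mu_t(x,T_t(y))+\mu_t(T_t(x),y))$. *)

theory Defs
  imports "HOL-Computational_Algebra.Formal_Power_Series"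
begin

unbundle fps_syntax

section \<open>Rota-Baxter Leibniz algebras\<close>

definition bilinear_map ::
    "('r::comm_ring_1 \<Rightarrow> 'v::ab_group_add \<Rightarrow> 'v) \<Rightarrow> ('v \<Rightarrow> 'v \<Rightarrow> 'v) \<Rightarrow> bool" where
  "bilinear_map scale b \<longleftrightarrow>
     (\<forall>x. module_hom scale scale (\<lambda>y. b x y)) \<and> (\<forall>y. module_hom scale scale (\<lambda>x. b x y))"

text \<open>The locales are stated over a commutative ring, because they are used both over the
  ground field \<open>K\<close> and over \<open>K[[t]]\<close>; over a field, \<^const>\<open>module\<close> is \<^const>\<open>vector_space\<close>.\<close>

locale leibniz_algebra = module scale
  for scale :: "'r::comm_ring_1 \<Rightarrow> 'v::ab_group_add \<Rightarrow> 'v" +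
  fixes \<mu> :: "'v \<Rightarrow> 'v \<Rightarrow> 'v"
  assumes bracket_bilinear: "bilinear_map scale \<mu>"
    and leibniz: "\<mu> x (\<mu> y z) = \<mu> (\<mu> x y) z + \<mu> y (\<mu> x z)"

locale rota_baxter_leibniz_algebra = leibniz_algebra scale \<mu>
  for scale :: "'r::comm_ring_1 \<Rightarrow> 'v::ab_group_add \<Rightarrow> 'v" and \<mu> +
  fixes T :: "'v \<Rightarrow> 'v"
  assumes operator_linear: "module_hom scale scale T"
    and rota_baxter: "\<mu> (T x) (T y) = T (\<mu> (T x) y + \<mu> x (T y))"

section \<open>The cochain complex\<close>

text \<open>An element \<open>f\<close> of \<open>Hom(g\<^sup>\<otimes>\<^sup>n, g)\<close> is a multilinear function of the list
  \<open>[x\<^sub>1, \<dots>, x\<^sub>n]\<close>; it is normalised to be \<open>0\<close> on lists of any other length, so that equality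
  of cochains is equality of functions.  For \<open>n = 0\<close> this is \<open>g\<close> itself, via \<open>f []\<close>.\<close>

definition cochains ::
    "('k::field \<Rightarrow> 'g::ab_group_add \<Rightarrow> 'g) \<Rightarrow> nat \<Rightarrow> ('g list \<Rightarrow> 'g) set" where
  "cochains scale n =
     {f. (\<forall>xs. length xs \<noteq> n \<longrightarrow> f xs = 0) \<and>
         (\<forall>xs i. length xs = n \<longrightarrow> i < n \<longrightarrow> module_hom scale scale (\<lambda>v. f (xs[i := v])))}"

text \<open>\<open>entry i xs\<close> is \<open>x\<^sub>i\<close> and \<open>omit i xs\<close> is \<open>x\<^sub>1, \<dots>, x\<^sub>i\<^sub>-\<^sub>1, x\<^sub>i\<^sub>+\<^sub>1, \<dots>\<close>, with positions counted
  from 1 as in the formulas below, whereas list indices start at 0.\<close>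

definition entry :: "nat \<Rightarrow> 'a list \<Rightarrow> 'a" where
  "entry i xs = xs ! (i - 1)"

definition replace :: "nat \<Rightarrow> 'a \<Rightarrow> 'a list \<Rightarrow> 'a list" where
  "replace i y xs = xs[i - 1 := y]"

definition omit :: "nat \<Rightarrow> 'a list \<Rightarrow> 'a list" where
  "omit i xs = take (i - 1) xs @ drop i xs"

text \<open>The common formula for \<open>\<delta>\<^sup>n\<close> and \<open>\<partial>\<^sup>n\<close>, with left action \<open>l\<close>, right action \<open>r\<close> and
  bracket \<open>br\<close>.\<close>

definition leibniz_differential ::
    "('k::field \<Rightarrow> 'g::ab_group_add \<Rightarrow> 'g) \<Rightarrow> ('g \<Rightarrow> 'g \<Rightarrow> 'g) \<Rightarrow> ('g \<Rightarrow> 'g \<Rightarrow> 'g) \<Rightarrow>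
     ('g \<Rightarrow> 'g \<Rightarrow> 'g) \<Rightarrow> nat \<Rightarrow> ('g list \<Rightarrow> 'g) \<Rightarrow> 'g list \<Rightarrow> 'g" where
  "leibniz_differential scale l r br n f xs =
     (if length xs = n + 1 then
        (\<Sum>i = 1..n. scale ((- 1) ^ (i + 1)) (l (entry i xs) (f (omit i xs))))
        + scale ((- 1) ^ (n + 1)) (r (f (omit (n + 1) xs)) (entry (n + 1) xs))
        + (\<Sum>(i, j) \<in> {(i, j). 1 \<le> i \<and> i < j \<and> j \<le> n + 1}.
             scale ((- 1) ^ i) (f (omit i (replace j (br (entry i xs) (entry j xs)) xs))))
      else 0)"

definition delta ::
    "('k::field \<Rightarrow> 'g::ab_group_add \<Rightarrow> 'g) \<Rightarrow> ('g \<Rightarrow> 'g \<Rightarrow> 'g) \<Rightarrow>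
     nat \<Rightarrow> ('g list \<Rightarrow> 'g) \<Rightarrow> 'g list \<Rightarrow> 'g" where
  "delta scale \<mu> = leibniz_differential scale (\<lambda>x u. \<mu> x u) (\<lambda>u x. \<mu> u x) \<mu>"

definition partial ::
    "('k::field \<Rightarrow> 'g::ab_group_add \<Rightarrow> 'g) \<Rightarrow> ('g \<Rightarrow> 'g \<Rightarrow> 'g) \<Rightarrow> ('g \<Rightarrow> 'g) \<Rightarrow>
     nat \<Rightarrow> ('g list \<Rightarrow> 'g) \<Rightarrow> 'g list \<Rightarrow> 'g" where
  "partial scale \<mu> T =
     leibniz_differential scale
       (\<lambda>x u. \<mu> (T x) u - T (\<mu> x u))
       (\<lambda>u x. \<mu> u (T x) - T (\<mu> u x))
       (\<lambda>x y. \<mu> x (T y) + \<mu> (T x) y)"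

definition phi ::
    "('g::ab_group_add \<Rightarrow> 'g) \<Rightarrow> nat \<Rightarrow> ('g list \<Rightarrow> 'g) \<Rightarrow> 'g list \<Rightarrow> 'g" where
  "phi T n f xs =
     (if length xs = n then
        f (map T xs) - (\<Sum>i = 1..n. T (f (replace i (entry i xs) (map T xs))))
      else 0)"

text \<open>The groups \<open>C\<^sup>n\<^sub>R\<^sub>B\<^sub>L\<^sub>A\<close> and the differential \<open>d\<^sup>n\<close> are only meaningful for \<open>n \<ge> 1\<close>.\<close>

definition rbla_cochains ::
    "('k::field \<Rightarrow> 'g::ab_group_add \<Rightarrow> 'g) \<Rightarrow> nat \<Rightarrow> (('g list \<Rightarrow> 'g) \<times> ('g list \<Rightarrow> 'g)) set" where
  "rbla_cochains scale n = cochains scale n \<times> cochains scale (n - 1)"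

definition rbla_differential ::
    "('k::field \<Rightarrow> 'g::ab_group_add \<Rightarrow> 'g) \<Rightarrow> ('g \<Rightarrow> 'g \<Rightarrow> 'g) \<Rightarrow> ('g \<Rightarrow> 'g) \<Rightarrow> nat \<Rightarrow>
     ('g list \<Rightarrow> 'g) \<times> ('g list \<Rightarrow> 'g) \<Rightarrow> ('g list \<Rightarrow> 'g) \<times> ('g list \<Rightarrow> 'g)" where
  "rbla_differential scale \<mu> T n =
     (\<lambda>(\<alpha>, \<beta>). (delta scale \<mu> n \<alpha>, \<lambda>xs. - partial scale \<mu> T (n - 1) \<beta> xs - phi T n \<alpha> xs))"

definition rbla_cocycles ::
    "('k::field \<Rightarrow> 'g::ab_group_add \<Rightarrow> 'g) \<Rightarrow> ('g \<Rightarrow> 'g \<Rightarrow> 'g) \<Rightarrow> ('g \<Rightarrow> 'g) \<Rightarrow> nat \<Rightarrow>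
     (('g list \<Rightarrow> 'g) \<times> ('g list \<Rightarrow> 'g)) set" where
  "rbla_cocycles scale \<mu> T n =
     {c \<in> rbla_cochains scale n. rbla_differential scale \<mu> T n c = (\<lambda>xs. 0, \<lambda>xs. 0)}"

text \<open>A linear map \<open>g \<rightarrow> g\<close> and a bilinear map \<open>g \<times> g \<rightarrow> g\<close> as elements of \<open>Hom(g, g)\<close> and
  \<open>Hom(g \<otimes> g, g)\<close> in the encoding of \<^const>\<open>cochains\<close>.\<close>

definition cochain1 :: "('g \<Rightarrow> 'g::zero) \<Rightarrow> 'g list \<Rightarrow> 'g" where
  "cochain1 h xs = (case xs of [x] \<Rightarrow> h x | _ \<Rightarrow> 0)"

definition cochain2 :: "('g \<Rightarrow> 'g \<Rightarrow> 'g::zero) \<Rightarrow> 'g list \<Rightarrow> 'g" where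
  "cochain2 b xs = (case xs of [x, y] \<Rightarrow> b x y | _ \<Rightarrow> 0)"

section \<open>Formal one-parameter deformations\<close>

text \<open>\<open>g[[t]]\<close> is the type \<open>'g fps\<close>, a \<open>K[[t]]\<close>-module under the Cauchy product.  The power
  series \<open>\<Sum>\<^sub>i T\<^sub>i t\<^sup>i\<close> and \<open>\<Sum>\<^sub>i \<mu>\<^sub>i t\<^sup>i\<close> are given by their coefficient sequences and act on \<open>g[[t]]\<close> by
  their (\<open>t\<close>-adically continuous) \<open>K[[t]]\<close>-linear extensions.\<close>

definition scale_fps ::
    "('k::field \<Rightarrow> 'g::ab_group_add \<Rightarrow> 'g) \<Rightarrow> 'k fps \<Rightarrow> 'g fps \<Rightarrow> 'g fps" where
  "scale_fps scale a v = Abs_fps (\<lambda>n. \<Sum>i = 0..n. scale (a $ i) (v $ (n - i)))"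

definition linear_ext :: "(nat \<Rightarrow> 'g \<Rightarrow> 'g::ab_group_add) \<Rightarrow> 'g fps \<Rightarrow> 'g fps" where
  "linear_ext T v = Abs_fps (\<lambda>n. \<Sum>i = 0..n. T i (v $ (n - i)))"

definition bilinear_ext ::
    "(nat \<Rightarrow> 'g \<Rightarrow> 'g \<Rightarrow> 'g::ab_group_add) \<Rightarrow> 'g fps \<Rightarrow> 'g fps \<Rightarrow> 'g fps" where
  "bilinear_ext \<mu> u v =
     Abs_fps (\<lambda>n. \<Sum>i = 0..n. \<Sum>j = 0..n - i. \<mu> i (u $ j) (v $ (n - i - j)))"

definition formal_deformation ::
    "('k::field \<Rightarrow> 'g::ab_group_add \<Rightarrow> 'g) \<Rightarrow> ('g \<Rightarrow> 'g \<Rightarrow> 'g) \<Rightarrow> ('g \<Rightarrow> 'g) \<Rightarrow>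
     (nat \<Rightarrow> 'g \<Rightarrow> 'g \<Rightarrow> 'g) \<Rightarrow> (nat \<Rightarrow> 'g \<Rightarrow> 'g) \<Rightarrow> bool" where
  "formal_deformation scale \<mu> T \<mu>t Tt \<longleftrightarrow>
     (\<forall>i. bilinear_map scale (\<mu>t i)) \<and>
     (\<forall>i. module_hom scale scale (Tt i)) \<and>
     \<mu>t 0 = \<mu> \<and> Tt 0 = T \<and>
     rota_baxter_leibniz_algebra (scale_fps scale) (bilinear_ext \<mu>t) (linear_ext Tt)"

end

theory Submission
  imports Defs
begin

text \<open>The \<open>2\<close>-cocycle conditions are the coefficients of \<open>t\<close> in the Leibniz identity and in the
  Rota-Baxter identity for \<open>(\<mu>\<^sub>t, T\<^sub>t)\<close>, evaluated at constant power series.\<close>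

text \<open>The coefficient of \<open>t\<close> in a composite of extensions depends only on
  coefficients 0 and 1 of its parts, so four rules suffice to expand both identities.\<close>

lemma linear_ext_nth_0: "linear_ext h v $ 0 = h 0 (v $ 0)"
  by (simp add: linear_ext_def)

lemma linear_ext_nth_1: "linear_ext h v $ 1 = h 0 (v $ 1) + h 1 (v $ 0)"
  by (simp add: linear_ext_def)

lemma bilinear_ext_nth_0: "bilinear_ext m u v $ 0 = m 0 (u $ 0) (v $ 0)"
  by (simp add: bilinear_ext_def)

lemma bilinear_ext_nth_1:
  "bilinear_ext m u v $ 1 = m 0 (u $ 0) (v $ 1) + m 0 (u $ 1) (v $ 0) + m 1 (u $ 0) (v $ 0)"
  by (simp add: bilinear_ext_def)

lemmas ext_nth = linear_ext_nth_0 linear_ext_nth_1 bilinear_ext_nth_0 bilinear_ext_nth_1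

text \<open>Constant series have zero coefficient of \<open>t\<close>; this removes the terms that
  contain it.\<close>

lemma bilinear_map_zero:
  assumes "bilinear_map scale b"
  shows "b 0 y = 0" "b x 0 = 0"
  using assms module_hom.zero[of scale scale "\<lambda>x. b x y"] module_hom.zero[of scale scale "b x"]
  by (auto simp: bilinear_map_def)

lemma cochain1_in_cochains:
  assumes "module_hom scale scale h"
  shows "cochain1 h \<in> cochains scale 1"
  using assms
  by (auto simp: cochains_def cochain1_def length_Suc_conv split: list.splits)

lemma cochain2_in_cochains:
  assumes "bilinear_map scale b"
  shows "cochain2 b \<in> cochains scale 2"
  using assms
  by (auto simp: cochains_def cochain2_def bilinear_map_def numeral_2_eq_2 length_Suc_conv
      less_Suc_eq split: list.splits)

text \<open>The bracket terms for the pairs (1,2) and (1,3) carry the sign -1, the one for (2,3) the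
  sign +1, as in the Leibniz identity with everything moved to one side.\<close>

lemma delta_cochain2:
  assumes "vector_space scale"
  shows "delta scale \<mu> 2 (cochain2 b) [x, y, z] =
    \<mu> x (b y z) - \<mu> y (b x z) - \<mu> (b x y) z - b (\<mu> x y) z - b y (\<mu> x z) + b x (\<mu> y z)"
proof -
  interpret vector_space scale by fact
  have pairs: "{(i, j). 1 \<le> i \<and> i < j \<and> j \<le> 2 + 1} = {(1, 2), (1, 3), (2, 3 :: nat)}"
    by auto
  have range: "{1..2} = {1, 2 :: nat}"
    by auto
  show ?thesis
    unfolding delta_def leibniz_differential_def pairs range
    by (simp add: cochain2_def entry_def replace_def omit_def algebra_simps)
qed

text \<open>The only index pair (1,2) contributes \<open>h\<close> at the bracket induced by
  \<open>T\<close>; the other four terms come from the two actions twisted by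
  \<open>T\<close>.\<close>

lemma partial_cochain1:
  assumes "vector_space scale"
  shows "partial scale \<mu> T 1 (cochain1 h) [x, y] =
    \<mu> (T x) (h y) - T (\<mu> x (h y)) + \<mu> (h x) (T y) - T (\<mu> (h x) y) - h (\<mu> x (T y) + \<mu> (T x) y)"
proof -
  interpret vector_space scale by fact
  have pairs: "{(i, j). 1 \<le> i \<and> i < j \<and> j \<le> 1 + 1} = {(1, 2 :: nat)}"
    by auto
  show ?thesis
    unfolding partial_def leibniz_differential_def pairs
    by (simp add: cochain1_def entry_def replace_def omit_def algebra_simps)
qed

lemma phi_cochain2:
  "phi T 2 (cochain2 b) [x, y] = b (T x) (T y) - T (b x (T y)) - T (b (T x) y)"
proof -
  have range: "{1..2} = {1, 2 :: nat}"
    by auto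
  show ?thesis
    unfolding phi_def range
    by (simp add: cochain2_def entry_def replace_def algebra_simps)
qed

context
  fixes scale :: "'k::field \<Rightarrow> 'g::ab_group_add \<Rightarrow> 'g"
    and \<mu> T \<mu>t Tt
  assumes deformation: "formal_deformation scale \<mu> T \<mu>t Tt"
begin

text \<open>At constants, the order 1 part of a double bracket is a sum over which of its two
  brackets supplies \<open>\<mu>t 1\<close>, the other being \<open>\<mu>\<close>.\<close>

lemma deformation_leibniz_order_1:
  "\<mu> x (\<mu>t 1 y z) + \<mu>t 1 x (\<mu> y z) =
    \<mu> (\<mu>t 1 x y) z + \<mu>t 1 (\<mu> x y) z + (\<mu> y (\<mu>t 1 x z) + \<mu>t 1 y (\<mu> x z))"
proof -
  interpret leibniz_algebra "scale_fps scale" "bilinear_ext \<mu>t"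
    using deformation
    by (simp add: formal_deformation_def rota_baxter_leibniz_algebra_def)
  have "bilinear_map scale \<mu>" "\<mu>t 0 = \<mu>"
    using deformation by (auto simp: formal_deformation_def)
  then show ?thesis
    using arg_cong[OF leibniz[of "fps_const x" "fps_const y" "fps_const z"], of "\<lambda>s. s $ 1"]
    \<comment> \<open>Here \<open>simp\<close> turns the index 1 into \<open>Suc 0\<close>;
      \<open>[simplified]\<close> puts the rules in the same form.\<close>
    by (simp add: ext_nth[simplified] bilinear_map_zero)
qed

text \<open>The index 1 falls on the bracket or on one of two operators; on the right these are the
  outer and the inner one.\<close>

lemma deformation_rota_baxter_order_1:
  "\<mu> (T x) (Tt 1 y) + \<mu> (Tt 1 x) (T y) + \<mu>t 1 (T x) (T y) =
    T (\<mu> (Tt 1 x) y) + T (\<mu>t 1 (T x) y) + T (\<mu> x (Tt 1 y)) + T (\<mu>t 1 x (T y))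
    + Tt 1 (\<mu> (T x) y + \<mu> x (T y))"
proof -
  interpret rota_baxter_leibniz_algebra "scale_fps scale" "bilinear_ext \<mu>t" "linear_ext Tt"
    using deformation by (simp add: formal_deformation_def)
  have b: "bilinear_map scale \<mu>" "\<mu>t 0 = \<mu>" "Tt 0 = T"
    and T: "module_hom scale scale T"
    using deformation by (auto simp: formal_deformation_def)
  then show ?thesis
    using arg_cong[OF rota_baxter[of "fps_const x" "fps_const y"], of "\<lambda>s. s $ 1"]
    \<comment> \<open>\<open>T\<close> is split over sums, while \<open>Tt 1\<close> stays applied
      to the whole sum, as in \<open>partial_cochain1\<close>.\<close>
    by (simp add: ext_nth[simplified] bilinear_map_zero module_hom.add[OF T]
        module_hom.zero[OF T] add_ac)
qed

end

theorem theorem5p3: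
  fixes scale :: "'k::field \<Rightarrow> 'g::ab_group_add \<Rightarrow> 'g"
    and \<mu> :: "'g \<Rightarrow> 'g \<Rightarrow> 'g" and T :: "'g \<Rightarrow> 'g"
    and \<mu>t :: "nat \<Rightarrow> 'g \<Rightarrow> 'g \<Rightarrow> 'g" and Tt :: "nat \<Rightarrow> 'g \<Rightarrow> 'g"
  assumes "vector_space scale"
    and "rota_baxter_leibniz_algebra scale \<mu> T"
    and "formal_deformation scale \<mu> T \<mu>t Tt"
  shows "(cochain2 (\<mu>t 1), cochain1 (Tt 1)) \<in> rbla_cocycles scale \<mu> T 2"
proof -
  have "cochain2 (\<mu>t 1) \<in> cochains scale 2" "cochain1 (Tt 1) \<in> cochains scale 1"
    using assms(3)
    by (auto simp only: formal_deformation_def intro: cochain1_in_cochains cochain2_in_cochains)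
  then have cochain: "(cochain2 (\<mu>t 1), cochain1 (Tt 1)) \<in> rbla_cochains scale 2"
    by (simp add: rbla_cochains_def)
  have delta: "delta scale \<mu> 2 (cochain2 (\<mu>t 1)) xs = 0" for xs
  proof (cases "length xs = 3")
    case True
    then obtain x y z where "xs = [x, y, z]"
      by (auto simp: numeral_3_eq_3 length_Suc_conv)
    then show ?thesis
      using deformation_leibniz_order_1[OF assms(3), of x y z]
      by (simp only: delta_cochain2[OF assms(1)]) (simp add: algebra_simps)
  next
    case False
    then show ?thesis
      by (simp add: delta_def leibniz_differential_def)
  qed
  have rota_baxter: "- partial scale \<mu> T 1 (cochain1 (Tt 1)) xs - phi T 2 (cochain2 (\<mu>t 1)) xs = 0"
    for xs
  proof (cases "length xs = 2")
    case True
    then obtain x y where "xs = [x, y]"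
      by (auto simp: numeral_2_eq_2 length_Suc_conv)
    then show ?thesis
      using deformation_rota_baxter_order_1[OF assms(3), of x y]
      \<comment> \<open>Expansion comes first, since plain \<open>simp\<close> would turn the degree
        1 into \<open>Suc 0\<close> and block \<open>partial_cochain1\<close>.\<close>
      by (simp only: partial_cochain1[OF assms(1)] phi_cochain2) (simp add: algebra_simps)
  next
    \<comment> \<open>\<open>partial\<close> raises degree 1 to 2 and \<open>phi\<close> keeps
      degree 2, so both vanish by default on lists of any other length.\<close>
    case False
    then show ?thesis
      by (simp add: partial_def leibniz_differential_def phi_def)
  qed
  show ?thesis
    using cochain delta rota_baxter
    by (simp add: rbla_cocycles_def rbla_differential_def fun_eq_iff)
qed

end
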